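(* Let $d\ge 1$, $q\ge 0$, let $\Omega\subseteq\mathbf{R}^d$ be a region and $w\ge 0$ a suitable weight function on $\Omega$. Let $n=\binom{d+q}{d}=\dim\mathcal{P}_q$, let $A_1,\dots,A_d$ be the $n\times n$ matrix representations of the operators $\chi_1,\dots,\chi_d$ in an orthonormal basis $\{e_a\}_{a=1}^n$ of $\mathcal{P}_q$, i.e. $(A_i)_{ab}=\langle e_a|\chi_ie_b\rangle$, and let $\iota:\mathcal{P}_q\to\mathbf{R}^N$ be the linear map sending $e_a$ to the $a$-th standard basis vector. Let $\tilde A_1,\dots,\tilde A_d$ be $N\times N$ symmetric commuting extensions of $A_1,\dots,A_d$ satisfying the compatibility condition $$\tilde A_i\,\iota p=\iota(x_ip)=\iota(\chi_ip)\qquad\text{for all }p\in\mathcal{P}_{q-1},\ i=1,\dots,d.$$ Let $\{\mathbf{u}_\alpha\}_{\alpha=1}^N$ be an orthonormal basis of $\mathbf{R}^N$ consisting of joint eigenvectors, $\tilde A_i\mathbf{u}_\alpha=\Lambda_{i\alpha}\mathbf{u}_\alpha$, and let $\lambda_\alpha=(\Lambda_{1\alpha},\dots,\Lambda_{d\alpha})\in\mathbf{R}^d$. Then for every polynomial $f\in\mathcal{P}_{2q+1}$ $$\int_\Omega w(x)f(x)\,d^dx=\sum_{\alpha=1}^N\langle\iota 1|\mathbf{u}_\alpha\rangle^2 f(\lambda_\alpha),$$ where $\iota 1$ is the image under $\iota$ of the constant polynomial $1$ and the inner product on the right is the standard one on $\mathbf{R}^N$.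
   Context: All matrices are real. "Suitable" weight: $\Omega\subseteq\mathbf{R}^d$ and $w:\Omega\to[0,\infty)$ are measurable, $\int_\Omega w(x)|p(x)|\,d^dx<\infty$ for every polynomial $p$, and $\int_\Omega w(x)p(x)^2\,d^dx>0$ for every nonzero polynomial $p$. $\mathcal{P}_m$ is the real vector space of polynomials in $x_1,\dots,x_d$ of total degree at most $m$ (with $\mathcal{P}_{-1}=\{0\}$), with inner product $\langle a|b\rangle=\int_\Omega w(x)a(x)b(x)\,d^dx$; $\mathcal{P}_{q-1}$ is regarded as a subspace of $\mathcal{P}_q$. $\Pi_q:\mathcal{P}_{q+1}\to\mathcal{P}_q$ is the orthogonal projection with respect to this inner product, and $\chi_i:\mathcal{P}_q\to\mathcal{P}_q$ is defined by $\chi_ip=\Pi_q(x_ip)$. $N\times N$ matrices $\tilde A_1,\dots,\tilde A_d$ are symmetric commuting extensions of $A_1,\dots,A_d$ ($N\ge n$) if each $\tilde A_i$ is symmetric, the top left $n\times n$ block of $\tilde A_i$ is $A_i$ for each $i$, and the $\tilde A_i$ pairwise commute. *)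

theory Defs
  imports "HOL-Analysis.Analysis" "Jordan_Normal_Form.VS_Connect" "Jordan_Normal_Form.Char_Poly"
begin

text \<open>
  Real polynomials in the coordinates of \<^typ>\<open>real ^ 'd\<close> are identified with the functions they
  induce. The degree bound is an integer so that the space of polynomials of degree at most
  \<open>-1\<close> is the zero space.
\<close>

definition monomial_fun :: "('d::finite \<Rightarrow> nat) \<Rightarrow> real ^ 'd \<Rightarrow> real" where
  "monomial_fun k x = (\<Prod>i\<in>UNIV. vec_nth x i ^ k i)"

definition multi_indices :: "int \<Rightarrow> ('d::finite \<Rightarrow> nat) set" where
  "multi_indices m = {k. int (\<Sum>i\<in>UNIV. k i) \<le> m}"

definition poly_space :: "int \<Rightarrow> (real ^ 'd::finite \<Rightarrow> real) set" where
  "poly_space m = {p. \<exists>c. p = (\<lambda>x. \<Sum>k\<in>multi_indices m. c k * monomial_fun k x)}"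

lemma finite_multi_indices: "finite (multi_indices m :: ('d::finite \<Rightarrow> nat) set)"
proof (rule finite_subset)
  show "multi_indices m \<subseteq> (PiE UNIV (\<lambda>_. {..nat m}) :: ('d \<Rightarrow> nat) set)"
  proof
    fix k :: "'d \<Rightarrow> nat" assume "k \<in> multi_indices m"
    then have *: "int (\<Sum>i\<in>UNIV. k i) \<le> m" by (simp add: multi_indices_def)
    have "k i \<le> nat m" for i
    proof -
      have "k i \<le> (\<Sum>i\<in>UNIV. k i)" by (rule member_le_sum) auto
      with * show ?thesis by linarith
    qed
    then show "k \<in> PiE UNIV (\<lambda>_. {..nat m})" by auto
  qed
qed (intro finite_PiE; simp)

lemma poly_space_neg: "poly_space (- 1) = {\<lambda>x :: real ^ 'd::finite. 0}"
proof -
  have "multi_indices (- 1) = ({} :: ('d \<Rightarrow> nat) set)"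
    by (auto simp: multi_indices_def) (smt (verit) of_nat_0_le_iff sum_nonneg)
  then show ?thesis by (simp add: poly_space_def)
qed

lemma monomial_in_poly_space:
  assumes "int (\<Sum>i\<in>UNIV. k i) \<le> m"
  shows "(\<lambda>x. c * monomial_fun k x) \<in> poly_space m"
proof -
  have k: "k \<in> multi_indices m"
    using assms by (simp add: multi_indices_def)
  have "c * monomial_fun k x =
    (\<Sum>l\<in>multi_indices m. (if l = k then c else 0) * monomial_fun l x)" for x
    using k by (simp add: if_distrib [of "\<lambda>a. a * _"] finite_multi_indices cong: if_cong)
  then show ?thesis unfolding poly_space_def
    by (intro CollectI exI [of _ "\<lambda>l. if l = k then c else 0"]) auto
qed

lemma poly_space_add:
  assumes "p \<in> poly_space m" "r \<in> poly_space m"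
  shows "(\<lambda>x. p x + r x) \<in> poly_space m"
proof -
  obtain c d where "p = (\<lambda>x. \<Sum>k\<in>multi_indices m. c k * monomial_fun k x)"
    "r = (\<lambda>x. \<Sum>k\<in>multi_indices m. d k * monomial_fun k x)"
    using assms by (auto simp: poly_space_def)
  then show ?thesis unfolding poly_space_def
    by (intro CollectI exI [of _ "\<lambda>k. c k + d k"]) (simp add: sum.distrib distrib_right)
qed

lemma poly_space_sum:
  assumes "finite I" "\<And>i. i \<in> I \<Longrightarrow> f i \<in> poly_space m"
  shows "(\<lambda>x. \<Sum>i\<in>I. f i x) \<in> poly_space m"
  using assms
proof (induction I rule: finite_induct)
  case empty
  show ?case by (auto simp: poly_space_def intro!: exI [of _ "\<lambda>_. 0"])
qed (auto intro: poly_space_add)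

lemma poly_space_mono:
  assumes "p \<in> poly_space m" "m \<le> m'"
  shows "p \<in> poly_space m'"
proof -
  obtain c where c: "p = (\<lambda>x. \<Sum>k\<in>multi_indices m. c k * monomial_fun k x)"
    using assms by (auto simp: poly_space_def)
  show ?thesis unfolding c using assms(2)
    by (intro poly_space_sum monomial_in_poly_space finite_multi_indices) (auto simp: multi_indices_def)
qed

lemma poly_space_mult:
  assumes "p \<in> poly_space m" "r \<in> poly_space m'"
  shows "(\<lambda>x. p x * r x) \<in> poly_space (m + m')"
proof -
  obtain c d where c: "p = (\<lambda>x. \<Sum>k\<in>multi_indices m. c k * monomial_fun k x)"
    and d: "r = (\<lambda>x. \<Sum>k\<in>multi_indices m'. d k * monomial_fun k x)"
    using assms by (auto simp: poly_space_def)
  have mon: "monomial_fun (\<lambda>i. k i + l i) x = monomial_fun k x * monomial_fun l x"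
    for k l :: "'a \<Rightarrow> nat" and x
    by (simp add: monomial_fun_def power_add prod.distrib)
  have "(\<lambda>x. p x * r x) = (\<lambda>x. \<Sum>k\<in>multi_indices m. \<Sum>l\<in>multi_indices m'.
    (c k * d l) * monomial_fun (\<lambda>i. k i + l i) x)"
    by (simp add: c d sum_product mon mult_ac)
  also have "\<dots> \<in> poly_space (m + m')"
    by (intro poly_space_sum monomial_in_poly_space finite_multi_indices)
      (simp add: multi_indices_def sum.distrib)
  finally show ?thesis .
qed

lemma real_polynomial_function_iff_poly_space:
  "real_polynomial_function p \<longleftrightarrow> (\<exists>m. p \<in> poly_space m)"
proof
  assume "real_polynomial_function p"
  then show "\<exists>m. p \<in> poly_space m"
  proof (induction rule: real_polynomial_function.induct)
    case (linear f)
    then interpret bounded_linear f .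
    have f: "f = (\<lambda>x. \<Sum>i\<in>UNIV. f (axis i 1) * monomial_fun (\<lambda>j. if j = i then 1 else 0) x)"
    proof
      fix x
      have "f x = f (\<Sum>i\<in>UNIV. vec_nth x i *\<^sub>R axis i 1)"
        by (simp add: basis_expansion flip: scalar_mult_eq_scaleR)
      also have "\<dots> = (\<Sum>i\<in>UNIV. f (axis i 1) * vec_nth x i)"
        by (simp add: sum scaleR mult.commute)
      finally show "f x = (\<Sum>i\<in>UNIV. f (axis i 1) * monomial_fun (\<lambda>j. if j = i then 1 else 0) x)"
        by (simp add: monomial_fun_def if_distrib cong: if_cong)
    qed
    have "f \<in> poly_space 1"
      by (subst f, intro poly_space_sum monomial_in_poly_space) auto
    then show ?case ..
  next
    case (const c)
    have "(\<lambda>x. c) \<in> poly_space 0"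
      using monomial_in_poly_space [of "\<lambda>_. 0" 0 c] by (simp add: monomial_fun_def)
    then show ?case ..
  next
    case (add f g)
    then obtain m m' where "f \<in> poly_space m" "g \<in> poly_space m'" by auto
    then have "f \<in> poly_space (max m m')" "g \<in> poly_space (max m m')"
      by (auto intro: poly_space_mono)
    then show ?case using poly_space_add by blast
  next
    case (mult f g)
    then show ?case using poly_space_mult by blast
  qed
next
  assume "\<exists>m. p \<in> poly_space m"
  then obtain m c where p: "p = (\<lambda>x. \<Sum>k\<in>multi_indices m. c k * monomial_fun k x)"
    by (auto simp: poly_space_def)
  have "real_polynomial_function (\<lambda>x :: real ^ 'a. vec_nth x i)" for i
    by (rule real_polynomial_function.intros(1)) (rule bounded_linear_vec_nth)
  then show "real_polynomial_function p"
    unfolding p monomial_fun_def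
    by (intro real_polynomial_function_sum finite_multi_indices real_polynomial_function.intros(2,4)
        real_polynomial_function_prod real_polynomial_function_power)
      auto
qed

definition suitable_weight :: "(real ^ 'd::finite) set \<Rightarrow> (real ^ 'd \<Rightarrow> real) \<Rightarrow> bool" where
  "suitable_weight \<Omega> w \<longleftrightarrow>
     \<Omega> \<in> sets lebesgue \<and> set_borel_measurable lebesgue \<Omega> w \<and> (\<forall>x\<in>\<Omega>. 0 \<le> w x) \<and>
     (\<forall>p. real_polynomial_function p \<longrightarrow> set_integrable lebesgue \<Omega> (\<lambda>x. w x * \<bar>p x\<bar>)) \<and>
     (\<forall>p. real_polynomial_function p \<and> p \<noteq> (\<lambda>x. 0) \<longrightarrow> 0 < (LINT x:\<Omega>|lebesgue. w x * (p x)\<^sup>2))"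

definition weight_inner ::
  "(real ^ 'd::finite) set \<Rightarrow> (real ^ 'd \<Rightarrow> real) \<Rightarrow> (real ^ 'd \<Rightarrow> real) \<Rightarrow> (real ^ 'd \<Rightarrow> real) \<Rightarrow> real" where
  "weight_inner \<Omega> w a b = (LINT x:\<Omega>|lebesgue. w x * a x * b x)"

text \<open>
  For a suitable weight the following description determines a unique polynomial whenever
  \<open>p\<close> is a polynomial.
\<close>

definition orth_proj ::
  "(real ^ 'd::finite) set \<Rightarrow> (real ^ 'd \<Rightarrow> real) \<Rightarrow> nat \<Rightarrow> (real ^ 'd \<Rightarrow> real) \<Rightarrow> (real ^ 'd \<Rightarrow> real)" where
  "orth_proj \<Omega> w q p =
     (THE r. r \<in> poly_space (int q) \<and>
             (\<forall>s\<in>poly_space (int q). weight_inner \<Omega> w (\<lambda>x. p x - r x) s = 0))"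

definition mult_op ::
  "(real ^ 'd::finite) set \<Rightarrow> (real ^ 'd \<Rightarrow> real) \<Rightarrow> nat \<Rightarrow> 'd \<Rightarrow> (real ^ 'd \<Rightarrow> real) \<Rightarrow> (real ^ 'd \<Rightarrow> real)" where
  "mult_op \<Omega> w q i p = orth_proj \<Omega> w q (\<lambda>x. vec_nth x i * p x)"

text \<open>Basis elements, like rows and columns of matrices, are numbered from \<open>0\<close>.\<close>

definition orthonormal_poly_basis ::
  "(real ^ 'd::finite) set \<Rightarrow> (real ^ 'd \<Rightarrow> real) \<Rightarrow> nat \<Rightarrow> nat \<Rightarrow> (nat \<Rightarrow> real ^ 'd \<Rightarrow> real) \<Rightarrow> bool" where
  "orthonormal_poly_basis \<Omega> w q n e \<longleftrightarrow>
     (\<forall>a<n. e a \<in> poly_space (int q)) \<and>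
     (\<forall>a<n. \<forall>b<n. weight_inner \<Omega> w (e a) (e b) = (if a = b then 1 else 0)) \<and>
     (\<forall>p\<in>poly_space (int q). \<exists>c. p = (\<lambda>x. \<Sum>a<n. c a * e a x))"

definition linear_poly_to_vec ::
  "nat \<Rightarrow> nat \<Rightarrow> ((real ^ 'd::finite \<Rightarrow> real) \<Rightarrow> real Matrix.vec) \<Rightarrow> bool" where
  "linear_poly_to_vec q N \<iota> \<longleftrightarrow>
     (\<forall>p\<in>poly_space (int q). \<iota> p \<in> carrier_vec N) \<and>
     (\<forall>p\<in>poly_space (int q). \<forall>r\<in>poly_space (int q). \<iota> (\<lambda>x. p x + r x) = \<iota> p + \<iota> r) \<and>
     (\<forall>c. \<forall>p\<in>poly_space (int q). \<iota> (\<lambda>x. c * p x) = c \<cdot>\<^sub>v \<iota> p)"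

definition symmetric_commuting_extensions ::
  "nat \<Rightarrow> nat \<Rightarrow> ('d \<Rightarrow> real mat) \<Rightarrow> ('d \<Rightarrow> real mat) \<Rightarrow> bool" where
  "symmetric_commuting_extensions n N A B \<longleftrightarrow>
     n \<le> N \<and>
     (\<forall>i. A i \<in> carrier_mat n n \<and> B i \<in> carrier_mat N N) \<and>
     (\<forall>i. transpose_mat (B i) = B i) \<and>
     (\<forall>i. \<forall>a<n. \<forall>b<n. B i $$ (a, b) = A i $$ (a, b)) \<and>
     (\<forall>i j. B i * B j = B j * B i)"

definition orthonormal_vec_basis :: "nat \<Rightarrow> (nat \<Rightarrow> real Matrix.vec) \<Rightarrow> bool" where
  "orthonormal_vec_basis N u \<longleftrightarrow>
     (\<forall>\<alpha><N. u \<alpha> \<in> carrier_vec N) \<and>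
     (\<forall>\<alpha><N. \<forall>\<beta><N. scalar_prod (u \<alpha>) (u \<beta>) = (if \<alpha> = \<beta> then 1 else 0)) \<and>
     vectorspace.basis class_ring (module_vec TYPE(real) N) (u ` {..<N})"

end

theory Submission
  imports Defs
begin

text \<open>
  Symmetry of the extensions and the compatibility condition give
  \<open>\<langle>\<iota> p|u\<^sub>\<alpha>\<rangle> = p \<lambda>\<^sub>\<alpha> * \<langle>\<iota> 1|u\<^sub>\<alpha>\<rangle>\<close> for monomials \<open>p\<close> of degree at most \<open>q\<close>, by moving one
  coordinate at a time onto the eigenvector. Since \<open>\<iota>\<close> is isometric and the leading blocks of the
  extensions represent \<open>\<chi>\<^sub>i\<close>, the integrals of \<open>p * r\<close> and \<open>x\<^sub>i * p * r\<close> are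
  \<open>\<langle>\<iota> p|\<iota> r\<rangle>\<close> and the quadratic form of the \<open>i\<close>-th extension at \<open>\<iota> p\<close>, \<open>\<iota> r\<close>; expanding in the
  eigenbasis gives the quadrature rule for such products, and every monomial of degree at most
  \<open>2 q + 1\<close> is of one of these two forms.
\<close>

section \<open>Polynomial spaces and factorization of monomials\<close>

lemma poly_space_scale:
  assumes "p \<in> poly_space m"
  shows "(\<lambda>x. c * p x) \<in> poly_space m"
proof -
  have "(\<lambda>_. c) \<in> (poly_space 0 :: (real ^ 'a \<Rightarrow> real) set)"
    using monomial_in_poly_space [of "\<lambda>_. 0" 0 c] by (simp add: monomial_fun_def)
  from poly_space_mult [OF this assms] show ?thesis by simp
qed

lemma real_polynomial_function_poly_space:
  "p \<in> poly_space m \<Longrightarrow> real_polynomial_function p"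
  using real_polynomial_function_iff_poly_space by blast

lemma monomial_fun_poly_space: "monomial_fun k \<in> poly_space (int (\<Sum>i\<in>UNIV. k i))"
  using monomial_in_poly_space [of k _ 1] by simp

lemma monomial_fun_poly_space_le:
  "(\<Sum>i\<in>UNIV. k i) \<le> m \<Longrightarrow> monomial_fun k \<in> poly_space (int m)"
  by (rule poly_space_mono [OF monomial_fun_poly_space]) (simp only: of_nat_le_iff)

lemma real_polynomial_function_vec_nth: "real_polynomial_function (\<lambda>x. vec_nth x i)"
  by (rule real_polynomial_function.intros(1)) (rule bounded_linear_vec_nth)

lemma monomial_fun_add: "monomial_fun (\<lambda>i. k i + l i) x = monomial_fun k x * monomial_fun l x"
  by (simp add: monomial_fun_def power_add prod.distrib)

lemma monomial_fun_unit: "monomial_fun (\<lambda>j. if j = i then 1 else 0) x = vec_nth x i"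
  by (simp add: monomial_fun_def if_distrib cong: if_cong)

text \<open>Peels a single coordinate off a nonconstant monomial. The degree equation is returned as
  well because inductions on the degree need the exact drop by one.\<close>

lemma multi_index_positive_part:
  fixes k :: "'d::finite \<Rightarrow> nat"
  assumes "0 < (\<Sum>i\<in>UNIV. k i)"
  obtains i l where "k = (\<lambda>j. l j + (if j = i then 1 else 0))"
    "(\<Sum>j\<in>UNIV. k j) = Suc (\<Sum>j\<in>UNIV. l j)"
proof -
  obtain i where i: "0 < k i"
    using assms by (metis gr0I less_numeral_extra(3) sum.neutral)
  \<comment> \<open>The truncated subtraction is exact: only coordinate \<open>i\<close> is lowered,
    and \<open>k i\<close> is positive.\<close>
  define l where "l j = k j - (if j = i then 1 else 0)" for j
  have k: "k = (\<lambda>j. l j + (if j = i then 1 else 0))"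
    using i by (auto simp: l_def)
  moreover have "(\<Sum>j\<in>UNIV. k j) = Suc (\<Sum>j\<in>UNIV. l j)"
    by (subst k) (simp add: sum.distrib)
  ultimately show ?thesis by (rule that)
qed

text \<open>Induction on \<open>m\<close>: as long as \<open>l\<close> has degree below that of
  \<open>k\<close>, the remainder \<open>l'\<close> has positive degree, so one unit can be moved
  from \<open>l'\<close> to \<open>l\<close>.\<close>

lemma multi_index_split:
  fixes k :: "'d::finite \<Rightarrow> nat"
  assumes "m \<le> (\<Sum>i\<in>UNIV. k i)"
  obtains l l' where "k = (\<lambda>i. l i + l' i)" "(\<Sum>i\<in>UNIV. l i) = m"
proof -
  have "\<exists>l l'. k = (\<lambda>i. l i + l' i) \<and> (\<Sum>i\<in>UNIV. l i) = m"
    using assms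
  proof (induction m)
    case 0
    then show ?case by (intro exI [of _ "\<lambda>_. 0"] exI [of _ k]) simp
  next
    case (Suc m)
    then obtain l l' where k: "k = (\<lambda>i. l i + l' i)" and l: "(\<Sum>i\<in>UNIV. l i) = m"
      by auto
    have "0 < (\<Sum>i\<in>UNIV. l' i)"
      using Suc.prems l by (simp add: k sum.distrib)
    then obtain i r where r: "l' = (\<lambda>j. r j + (if j = i then 1 else 0))"
      by (rule multi_index_positive_part)
    show ?case
      by (rule exI [of _ "\<lambda>j. l j + (if j = i then 1 else 0)"], rule exI [of _ r])
        (auto simp: k r l sum.distrib)
  qed
  then show ?thesis using that by blast
qed

text \<open>The source of the bound \<open>2 * q + 1\<close>: two factors of degree at most
  \<open>q\<close>, plus at most one extra coordinate. The first factor is filled up to degree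
  \<open>q\<close>; what remains has degree at most \<open>q + 1\<close>, and a coordinate is split
  off only when it equals \<open>q + 1\<close>.\<close>

lemma monomial_fun_split_odd:
  fixes k :: "'d::finite \<Rightarrow> nat"
  assumes "(\<Sum>i\<in>UNIV. k i) \<le> 2 * q + 1"
  obtains (even) l l' where "(\<Sum>i\<in>UNIV. l i) \<le> q" "(\<Sum>i\<in>UNIV. l' i) \<le> q"
      "monomial_fun k = (\<lambda>x. monomial_fun l x * monomial_fun l' x)"
    | (odd) l l' i where "(\<Sum>i\<in>UNIV. l i) \<le> q" "(\<Sum>i\<in>UNIV. l' i) \<le> q"
      "monomial_fun k = (\<lambda>x. monomial_fun l x * monomial_fun l' x * vec_nth x i)"
proof (cases "(\<Sum>i\<in>UNIV. k i) \<le> q")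
  case True
  moreover have "monomial_fun k = (\<lambda>x. monomial_fun k x * monomial_fun (\<lambda>_. 0) x)"
    by (simp add: monomial_fun_def fun_eq_iff)
  ultimately show ?thesis by (intro even [of k "\<lambda>_. 0"]) auto
next
  case False
  then obtain l l' where k: "k = (\<lambda>i. l i + l' i)" and l: "(\<Sum>i\<in>UNIV. l i) = q"
    using multi_index_split [of q k] by auto
  have l': "(\<Sum>i\<in>UNIV. l' i) \<le> q + 1"
    using assms l by (simp add: k sum.distrib)
  show ?thesis
  proof (cases "(\<Sum>i\<in>UNIV. l' i) \<le> q")
    case True
    moreover have "monomial_fun k = (\<lambda>x. monomial_fun l x * monomial_fun l' x)"
      by (simp add: k fun_eq_iff monomial_fun_add)
    ultimately show ?thesis using even [of l l'] l by simp
  next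
    case False
    then have "0 < (\<Sum>i\<in>UNIV. l' i)" by simp
    then obtain i r where r: "l' = (\<lambda>j. r j + (if j = i then 1 else 0))"
      "(\<Sum>j\<in>UNIV. l' j) = Suc (\<Sum>j\<in>UNIV. r j)"
      by (rule multi_index_positive_part)
    have "monomial_fun k = (\<lambda>x. monomial_fun l x * monomial_fun r x * vec_nth x i)"
      by (simp add: k r(1) fun_eq_iff monomial_fun_add monomial_fun_unit mult.assoc del: One_nat_def)
    then show ?thesis using odd [of l r i] l l' r(2) by simp
  qed
qed

section \<open>Integration of polynomials against the weight\<close>

text \<open>Suitability speaks of the absolute value of \<open>p\<close>. The signed integrand is
  dominated by that one, so only its measurability has to be added, and this comes from the
  continuity of \<open>p\<close>.\<close>

lemma suitable_weight_integrable:
  assumes "suitable_weight \<Omega> w" "real_polynomial_function p"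
  shows "set_integrable lebesgue \<Omega> (\<lambda>x. w x * p x)"
proof -
  have "set_integrable lebesgue \<Omega> (\<lambda>x. w x * \<bar>p x\<bar>)"
    and w: "(\<lambda>x. indicator \<Omega> x *\<^sub>R w x) \<in> borel_measurable lebesgue"
    using assms by (auto simp: suitable_weight_def set_borel_measurable_def)
  then have int: "integrable lebesgue (\<lambda>x. indicator \<Omega> x *\<^sub>R (w x * \<bar>p x\<bar>))"
    by (simp add: set_integrable_def)
  have p: "p \<in> borel_measurable lebesgue"
    using continuous_real_polymonial_function [OF assms(2)]
    by (intro measurable_completion)
      (auto intro!: borel_measurable_continuous_onI continuous_at_imp_continuous_on)
  \<comment> \<open>Measurability of \<open>w\<close> is known only after restriction to
    \<open>\<Omega>\<close>, so the indicator is grouped with \<open>w\<close> before multiplying by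
    \<open>p\<close>.\<close>
  have "(\<lambda>x. (indicator \<Omega> x *\<^sub>R w x) * p x) \<in> borel_measurable lebesgue"
    using w p by (rule borel_measurable_times)
  then have "(\<lambda>x. indicator \<Omega> x *\<^sub>R (w x * p x)) \<in> borel_measurable lebesgue"
    by (simp add: mult_ac)
  then show ?thesis unfolding set_integrable_def
    by (rule Bochner_Integration.integrable_bound [OF int]) (auto simp: abs_mult)
qed

lemma weight_integral_sum:
  assumes "suitable_weight \<Omega> w" "finite I" "\<And>i. i \<in> I \<Longrightarrow> real_polynomial_function (p i)"
  shows "(LINT x:\<Omega>|lebesgue. w x * (\<Sum>i\<in>I. c i * p i x)) =
    (\<Sum>i\<in>I. c i * (LINT x:\<Omega>|lebesgue. w x * p i x))"
proof -
  have "(LINT x:\<Omega>|lebesgue. w x * (\<Sum>i\<in>I. c i * p i x)) =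
    (LINT x:\<Omega>|lebesgue. \<Sum>i\<in>I. c i * (w x * p i x))"
    by (simp add: sum_distrib_left mult_ac)
  also have "\<dots> = (\<Sum>i\<in>I. LINT x:\<Omega>|lebesgue. c i * (w x * p i x))"
    using suitable_weight_integrable [OF assms(1) assms(3)]
    unfolding set_lebesgue_integral_def set_integrable_def scaleR_sum_right
    by (intro Bochner_Integration.integral_sum) (auto simp: mult.left_commute)
  finally show ?thesis by simp
qed

lemma weight_integral_diff:
  assumes "suitable_weight \<Omega> w" "real_polynomial_function p" "real_polynomial_function r"
  shows "(LINT x:\<Omega>|lebesgue. w x * (p x - r x)) =
    (LINT x:\<Omega>|lebesgue. w x * p x) - (LINT x:\<Omega>|lebesgue. w x * r x)"
  using set_integral_diff(2) [OF suitable_weight_integrable [OF assms(1,2)]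
      suitable_weight_integrable [OF assms(1,3)]]
  by (simp add: right_diff_distrib)

lemma weight_inner_eq: "weight_inner \<Omega> w a b = (LINT x:\<Omega>|lebesgue. w x * (a x * b x))"
  by (simp add: weight_inner_def mult.assoc)

lemma weight_inner_diff_left:
  assumes "suitable_weight \<Omega> w" "real_polynomial_function p" "real_polynomial_function r"
    "real_polynomial_function s"
  shows "weight_inner \<Omega> w (\<lambda>x. p x - r x) s = weight_inner \<Omega> w p s - weight_inner \<Omega> w r s"
  using weight_integral_diff [OF assms(1), of "\<lambda>x. p x * s x" "\<lambda>x. r x * s x"] assms(2-4)
  by (simp add: weight_inner_eq left_diff_distrib real_polynomial_function.intros)

lemma weight_inner_sum_left:
  assumes "suitable_weight \<Omega> w" "finite I" "\<And>i. i \<in> I \<Longrightarrow> real_polynomial_function (p i)"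
    "real_polynomial_function s"
  shows "weight_inner \<Omega> w (\<lambda>x. \<Sum>i\<in>I. c i * p i x) s = (\<Sum>i\<in>I. c i * weight_inner \<Omega> w (p i) s)"
  using weight_integral_sum [OF assms(1,2), of "\<lambda>i x. p i x * s x" c] assms(3-4)
  by (simp add: weight_inner_eq sum_distrib_right mult.assoc real_polynomial_function.intros)

lemma weight_inner_commute: "weight_inner \<Omega> w a b = weight_inner \<Omega> w b a"
  by (simp add: weight_inner_def mult_ac)

section \<open>Orthogonal projection and the multiplication operators\<close>

lemma orthonormal_poly_basis_expansion:
  assumes "orthonormal_poly_basis \<Omega> w q n e" "p \<in> poly_space (int q)"
  shows "\<exists>c. p = (\<lambda>x. \<Sum>a<n. c a * e a x)"
proof -
  have "\<forall>p\<in>poly_space (int q). \<exists>c. p = (\<lambda>x. \<Sum>a<n. c a * e a x)"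
    using assms(1) unfolding orthonormal_poly_basis_def by (elim conjE)
  from this assms(2) show ?thesis ..
qed

text \<open>Since \<open>orth_proj\<close> is a definite description, its properties become
  available only after existence and uniqueness. The Fourier sum in the basis \<open>e\<close> gives
  existence; strict positivity of the inner product gives uniqueness.\<close>

lemma orth_proj_orthogonal:
  assumes w: "suitable_weight \<Omega> w" and e: "orthonormal_poly_basis \<Omega> w q n e"
    and p: "real_polynomial_function p"
  shows "\<forall>s\<in>poly_space (int q). weight_inner \<Omega> w (\<lambda>x. p x - orth_proj \<Omega> w q p x) s = 0"
    and "orth_proj \<Omega> w q p \<in> poly_space (int q)"
proof -
  define r where "r = (\<lambda>x. \<Sum>a<n. weight_inner \<Omega> w p (e a) * e a x)"
  have e_space: "e a \<in> poly_space (int q)" if "a < n" for a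
    using e that by (simp add: orthonormal_poly_basis_def)
  then have e_poly: "real_polynomial_function (e a)" if "a < n" for a
    using that real_polynomial_function_poly_space by blast
  have r: "r \<in> poly_space (int q)"
    unfolding r_def by (intro poly_space_sum poly_space_scale e_space) auto
  then have r_poly: "real_polynomial_function r"
    by (rule real_polynomial_function_poly_space)
  have orth_e: "weight_inner \<Omega> w (e b) (\<lambda>x. p x - r x) = 0" if b: "b < n" for b
  proof -
    have "weight_inner \<Omega> w r (e b) = (\<Sum>a<n. weight_inner \<Omega> w p (e a) * weight_inner \<Omega> w (e a) (e b))"
      unfolding r_def using w e_poly b by (intro weight_inner_sum_left) auto
    also have "\<dots> = (\<Sum>a<n. if a = b then weight_inner \<Omega> w p (e a) else 0)"
      using e b by (intro sum.cong) (auto simp: orthonormal_poly_basis_def)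
    also have "\<dots> = weight_inner \<Omega> w p (e b)"
      using b by simp
    finally show ?thesis
      using weight_inner_diff_left [OF w p r_poly e_poly [OF b]] by (simp add: weight_inner_commute)
  qed
  have diff_poly: "real_polynomial_function (\<lambda>x. p x - r x)"
    using p r_poly by (rule real_polynomial_function_diff)
  have orth: "weight_inner \<Omega> w (\<lambda>x. p x - r x) s = 0" if s_space: "s \<in> poly_space (int q)" for s
  proof -
    obtain c where s: "s = (\<lambda>x. \<Sum>a<n. c a * e a x)"
      using orthonormal_poly_basis_expansion [OF e s_space] ..
    have "weight_inner \<Omega> w s (\<lambda>x. p x - r x) =
      (\<Sum>a<n. c a * weight_inner \<Omega> w (e a) (\<lambda>x. p x - r x))"
      unfolding s using w e_poly diff_poly by (intro weight_inner_sum_left) auto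
    then show ?thesis
      using orth_e by (simp add: weight_inner_commute)
  qed
  have unique: "r' = r"
    if r': "r' \<in> poly_space (int q)"
      "\<forall>s\<in>poly_space (int q). weight_inner \<Omega> w (\<lambda>x. p x - r' x) s = 0" for r'
  proof -
    \<comment> \<open>The difference of two candidates lies in the space itself, so both residuals
      may be tested against it.\<close>
    define s where "s = (\<lambda>x. r' x - r x)"
    have s: "s \<in> poly_space (int q)"
      using poly_space_add [OF r'(1) poly_space_scale [OF r, of "-1"]] by (simp add: s_def)
    have s_poly: "real_polynomial_function s" and r'_poly: "real_polynomial_function r'"
      using s r'(1) by (auto intro: real_polynomial_function_poly_space)
    \<comment> \<open>Orthogonality of the residuals says that \<open>r'\<close> and
      \<open>r\<close> both have the same product with \<open>s\<close> as \<open>p\<close>;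
      subtracting shows that \<open>s\<close> has norm zero.\<close>
    have "weight_inner \<Omega> w p s = weight_inner \<Omega> w r' s" "weight_inner \<Omega> w p s = weight_inner \<Omega> w r s"
      using r'(2) orth s weight_inner_diff_left [OF w p r'_poly s_poly]
        weight_inner_diff_left [OF w p r_poly s_poly] by auto
    then have "weight_inner \<Omega> w s s = 0"
      using weight_inner_diff_left [OF w r'_poly r_poly s_poly] by (simp add: s_def)
    then have "(LINT x:\<Omega>|lebesgue. w x * (s x)\<^sup>2) = 0"
      by (simp add: weight_inner_eq power2_eq_square)
    then have "s = (\<lambda>x. 0)"
      using w s_poly unfolding suitable_weight_def by (metis less_irrefl)
    then have "r' x - r x = 0" for x
      by (metis s_def)
    then show ?thesis by (simp add: fun_eq_iff)
  qed
  have eq: "orth_proj \<Omega> w q p = r"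
    unfolding orth_proj_def
  proof (rule the_equality)
    show "r \<in> poly_space (int q) \<and> (\<forall>s\<in>poly_space (int q). weight_inner \<Omega> w (\<lambda>x. p x - r x) s = 0)"
      by (intro conjI ballI r orth)
  qed (elim conjE, rule unique)
  show "\<forall>s\<in>poly_space (int q). weight_inner \<Omega> w (\<lambda>x. p x - orth_proj \<Omega> w q p x) s = 0"
    unfolding eq by (intro ballI orth)
  show "orth_proj \<Omega> w q p \<in> poly_space (int q)"
    unfolding eq by (rule r)
qed

lemma weight_inner_mult_op:
  assumes "suitable_weight \<Omega> w" "orthonormal_poly_basis \<Omega> w q n e"
    and p: "p \<in> poly_space (int q)" and s: "s \<in> poly_space (int q)"
  shows "weight_inner \<Omega> w s (mult_op \<Omega> w q i p) =
    (LINT x:\<Omega>|lebesgue. w x * (s x * p x * vec_nth x i))"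
proof -
  have xp: "real_polynomial_function (\<lambda>x. vec_nth x i * p x)"
    using real_polynomial_function_vec_nth real_polynomial_function_poly_space [OF p]
    by (rule real_polynomial_function.intros(4))
  note proj = orth_proj_orthogonal [OF assms(1,2) xp]
  have "weight_inner \<Omega> w (\<lambda>x. vec_nth x i * p x - mult_op \<Omega> w q i p x) s = 0"
    using proj(1) s by (simp add: mult_op_def)
  moreover have "real_polynomial_function (mult_op \<Omega> w q i p)"
    using proj(2) real_polynomial_function_poly_space unfolding mult_op_def by blast
  ultimately have "weight_inner \<Omega> w (\<lambda>x. vec_nth x i * p x) s = weight_inner \<Omega> w (mult_op \<Omega> w q i p) s"
    using weight_inner_diff_left [OF assms(1) xp _ real_polynomial_function_poly_space [OF s]] by simp
  then show ?thesis
    by (simp add: weight_inner_commute [of _ _ s]) (simp add: weight_inner_def mult_ac)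
qed

section \<open>Orthonormal bases and symmetric matrices\<close>

text \<open>Parseval's identity. The matrix \<open>U\<close> with rows \<open>u \<alpha>\<close>
  satisfies \<open>U * transpose_mat U = 1\<^sub>m N\<close> by orthonormality; as \<open>U\<close>
  is square, the factors may be exchanged, so \<open>U\<close> preserves scalar products.\<close>

lemma scalar_prod_orthonormal_expansion:
  fixes u :: "nat \<Rightarrow> real Matrix.vec"
  assumes u: "\<And>\<alpha>. \<alpha> < N \<Longrightarrow> u \<alpha> \<in> carrier_vec N"
    and orth: "\<And>\<alpha> \<beta>. \<alpha> < N \<Longrightarrow> \<beta> < N \<Longrightarrow> scalar_prod (u \<alpha>) (u \<beta>) = (if \<alpha> = \<beta> then 1 else 0)"
    and v: "v \<in> carrier_vec N" and z: "z \<in> carrier_vec N"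
  shows "scalar_prod v z = (\<Sum>\<alpha><N. scalar_prod v (u \<alpha>) * scalar_prod z (u \<alpha>))"
proof -
  define U where "U = mat N N (\<lambda>(\<alpha>, a). vec_index (u \<alpha>) a)"
  have U: "U \<in> carrier_mat N N" by (simp add: U_def)
  have row: "row U \<alpha> = u \<alpha>" if "\<alpha> < N" for \<alpha>
    using u [OF that] that by (auto simp: U_def)
  have "U * transpose_mat U = 1\<^sub>m N"
    using U by (intro eq_matI) (auto simp: row orth)
  then have UU: "transpose_mat U * U = 1\<^sub>m N"
    using mat_mult_left_right_inverse [OF U, of "transpose_mat U"] U by simp
  have "scalar_prod v z = scalar_prod v ((transpose_mat U * U) *\<^sub>v z)"
    using z by (simp add: UU)
  also have "\<dots> = scalar_prod v (transpose_mat U *\<^sub>v (U *\<^sub>v z))"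
    using U z by (subst assoc_mult_mat_vec [of _ N N _ N]) auto
  also have "\<dots> = scalar_prod (U *\<^sub>v v) (U *\<^sub>v z)"
    using transpose_vec_mult_scalar [of "transpose_mat U" N N "U *\<^sub>v z" v] U v z by simp
  also have "\<dots> = (\<Sum>\<alpha><N. scalar_prod v (u \<alpha>) * scalar_prod z (u \<alpha>))"
    using U u v z
    by (simp add: scalar_prod_def [of "U *\<^sub>v v"] row atLeast0LessThan comm_scalar_prod [of _ N])
  finally show ?thesis .
qed

lemma scalar_prod_symmetric_mat:
  fixes M :: "real mat"
  assumes "M \<in> carrier_mat N N" "transpose_mat M = M" "v \<in> carrier_vec N" "z \<in> carrier_vec N"
  shows "scalar_prod (M *\<^sub>v v) z = scalar_prod v (M *\<^sub>v z)"
  using transpose_vec_mult_scalar [of M N N z v] assms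
  by simp

section \<open>The embedding \<open>\<iota>\<close> and joint eigenvectors\<close>

lemma linear_poly_to_vecD:
  assumes "linear_poly_to_vec q N \<iota>" "p \<in> poly_space (int q)"
  shows "\<iota> p \<in> carrier_vec N"
    and "r \<in> poly_space (int q) \<Longrightarrow> \<iota> (\<lambda>x. p x + r x) = \<iota> p + \<iota> r"
    and "\<iota> (\<lambda>x. c * p x) = c \<cdot>\<^sub>v \<iota> p"
  using assms unfolding linear_poly_to_vec_def by blast+

text \<open>Shows \<open>\<iota>\<close> concretely: coordinates in the basis \<open>e\<close>,
  padded with zeros up to length \<open>N\<close>.\<close>

lemma linear_poly_to_vec_expansion:
  assumes \<iota>: "linear_poly_to_vec q N \<iota>" and unit: "\<And>a. a < n \<Longrightarrow> \<iota> (e a) = unit_vec N a"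
    and e: "\<And>a. a < n \<Longrightarrow> e a \<in> poly_space (int q)"
  shows "\<iota> (\<lambda>x. \<Sum>a<n. c a * e a x) = Matrix.vec N (\<lambda>a. if a < n then c a else 0)"
  using unit e
proof (induction n)
  case 0
  \<comment> \<open>The empty sum is beyond the reach of binary additivity; its image vanishes by
    homogeneity with the scalar \<open>0\<close>.\<close>
  have zero: "(\<lambda>_. 0) \<in> (poly_space (int q) :: (real ^ 'a \<Rightarrow> real) set)"
    using monomial_in_poly_space [of "\<lambda>_. 0" "int q" 0] by simp
  have carrier: "\<iota> (\<lambda>_. 0) \<in> carrier_vec N"
    and scale: "\<iota> (\<lambda>_. 0) = 0 \<cdot>\<^sub>v \<iota> (\<lambda>_. 0)"
    using linear_poly_to_vecD(1) [OF \<iota> zero] linear_poly_to_vecD(3) [OF \<iota> zero, of 0] by simp_all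
  have "vec_index (\<iota> (\<lambda>_. 0)) a = 0" if "a < N" for a
    by (subst scale) (use carrier that in simp)
  then show ?case using carrier by (intro eq_vecI) simp_all
next
  case (Suc n)
  have "(\<lambda>x. \<Sum>a<n. c a * e a x) \<in> poly_space (int q)" "(\<lambda>x. c n * e n x) \<in> poly_space (int q)"
    using Suc.prems by (auto intro!: poly_space_sum poly_space_scale)
  then have "\<iota> (\<lambda>x. (\<Sum>a<n. c a * e a x) + c n * e n x) =
      \<iota> (\<lambda>x. \<Sum>a<n. c a * e a x) + \<iota> (\<lambda>x. c n * e n x)"
    by (rule linear_poly_to_vecD(2) [OF \<iota>])
  also have "\<iota> (\<lambda>x. c n * e n x) = c n \<cdot>\<^sub>v \<iota> (e n)"
    using Suc.prems(2) by (intro linear_poly_to_vecD(3) [OF \<iota>]) simp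
  finally have "\<iota> (\<lambda>x. \<Sum>a<Suc n. c a * e a x) =
      Matrix.vec N (\<lambda>a. if a < n then c a else 0) + c n \<cdot>\<^sub>v unit_vec N n"
    using Suc by simp
  also have "\<dots> = Matrix.vec N (\<lambda>a. if a < Suc n then c a else 0)"
    by (intro eq_vecI) (auto simp: less_Suc_eq unit_vec_def)
  finally show ?case .
qed

text \<open>Induction on the degree. Writing the monomial as a coordinate times
  \<open>monomial_fun l\<close>, compatibility replaces the coordinate by \<open>B i\<close>, and
  symmetry moves \<open>B i\<close> onto \<open>v\<close>, where it acts as
  \<open>\<Lambda> i\<close>. Degree at most \<open>q\<close> for \<open>k\<close> leaves at most
  \<open>q - 1\<close> for \<open>l\<close>, exactly the range in which compatibility holds.\<close>

lemma scalar_prod_joint_eigenvector: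
  fixes k :: "'d::finite \<Rightarrow> nat"
  assumes \<iota>: "linear_poly_to_vec q N \<iota>"
    and B: "\<And>i. B i \<in> carrier_mat N N" "\<And>i. transpose_mat (B i) = B i"
    and compat: "\<And>i p. p \<in> poly_space (int q - 1) \<Longrightarrow> B i *\<^sub>v \<iota> p = \<iota> (\<lambda>x. vec_nth x i * p x)"
    and v: "v \<in> carrier_vec N" "\<And>i. B i *\<^sub>v v = \<Lambda> i \<cdot>\<^sub>v v"
    and k: "(\<Sum>i\<in>UNIV. k i) \<le> q"
  shows "scalar_prod (\<iota> (monomial_fun k)) v = monomial_fun k (\<chi> i. \<Lambda> i) * scalar_prod (\<iota> (\<lambda>_. 1)) v"
  using k
proof (induction "\<Sum>i\<in>UNIV. k i" arbitrary: k)
  case 0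
  then have "k = (\<lambda>_. 0)" by (auto simp: fun_eq_iff)
  then have "monomial_fun k = (\<lambda>_. 1)" by (simp add: monomial_fun_def fun_eq_iff)
  then show ?case by simp
next
  case (Suc m)
  then have "0 < (\<Sum>i\<in>UNIV. k i)" by simp
  then obtain i l where k: "k = (\<lambda>j. l j + (if j = i then 1 else 0))"
    and sum: "(\<Sum>j\<in>UNIV. k j) = Suc (\<Sum>j\<in>UNIV. l j)"
    by (rule multi_index_positive_part)
  have mono: "monomial_fun k x = vec_nth x i * monomial_fun l x" for x
    by (simp add: k monomial_fun_add monomial_fun_unit del: One_nat_def)
  have l: "monomial_fun l \<in> poly_space (int q - 1)"
    using Suc.prems sum by (intro poly_space_mono [OF monomial_fun_poly_space]) linarith
  then have \<iota>l: "\<iota> (monomial_fun l) \<in> carrier_vec N"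
    using \<iota> poly_space_mono [OF l, of "int q"] by (simp add: linear_poly_to_vec_def)
  have "monomial_fun k = (\<lambda>x. vec_nth x i * monomial_fun l x)"
    by (simp add: fun_eq_iff mono)
  then have "scalar_prod (\<iota> (monomial_fun k)) v = scalar_prod (B i *\<^sub>v \<iota> (monomial_fun l)) v"
    using compat [OF l, of i] by simp
  also have "\<dots> = \<Lambda> i * scalar_prod (\<iota> (monomial_fun l)) v"
    using scalar_prod_symmetric_mat [OF B \<iota>l v(1), of i] \<iota>l v by simp
  also have "\<dots> = \<Lambda> i * (monomial_fun l (\<chi> i. \<Lambda> i) * scalar_prod (\<iota> (\<lambda>_. 1)) v)"
    using Suc.hyps(1) [of l] Suc.hyps(2) Suc.prems sum by simp
  finally show ?case by (simp add: mono)
qed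

section \<open>Integrals of products as bilinear forms in coordinates\<close>

lemma weight_integral_bilinear:
  fixes n :: nat
  assumes w: "suitable_weight \<Omega> w" and e: "\<And>a. a < n \<Longrightarrow> real_polynomial_function (e a)"
    and g: "real_polynomial_function g"
  shows "(LINT x:\<Omega>|lebesgue. w x * ((\<Sum>a<n. c a * e a x) * (\<Sum>b<n. d b * e b x) * g x)) =
    (\<Sum>a<n. \<Sum>b<n. c a * d b * (LINT x:\<Omega>|lebesgue. w x * (e a x * e b x * g x)))"
proof -
  have "(\<Sum>a<n. c a * e a x) * (\<Sum>b<n. d b * e b x) * g x =
      (\<Sum>a<n. \<Sum>b<n. c a * d b * (e a x * e b x * g x))" for x
    by (subst sum_product) (simp add: sum_distrib_left sum_distrib_right mult_ac)
  \<comment> \<open>The double sum is flattened to one sum over pairs, so that linearity of the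
    integral over a single finite index set applies.\<close>
  then have expand: "(\<Sum>a<n. c a * e a x) * (\<Sum>b<n. d b * e b x) * g x =
      (\<Sum>ab\<in>{..<n} \<times> {..<n}. c (fst ab) * d (snd ab) * (e (fst ab) x * e (snd ab) x * g x))" for x
    by (simp add: sum.cartesian_product case_prod_beta)
  have "(LINT x:\<Omega>|lebesgue. w x * ((\<Sum>a<n. c a * e a x) * (\<Sum>b<n. d b * e b x) * g x)) =
      (\<Sum>ab\<in>{..<n} \<times> {..<n}. c (fst ab) * d (snd ab) *
        (LINT x:\<Omega>|lebesgue. w x * (e (fst ab) x * e (snd ab) x * g x)))"
    unfolding expand using e g
    by (intro weight_integral_sum w) (auto intro!: real_polynomial_function.intros(4))
  then show ?thesis
    by (simp add: sum.cartesian_product case_prod_beta)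
qed

text \<open>The zero padding cuts both the row and the column sum at \<open>n\<close>, so the form
  sees only the leading block, the part of an extension whose entries are prescribed.\<close>

lemma scalar_prod_leading_block:
  fixes M :: "real mat"
  assumes M: "M \<in> carrier_mat N N" and n: "n \<le> N"
  shows "scalar_prod (Matrix.vec N (\<lambda>a. if a < n then c a else 0))
      (M *\<^sub>v Matrix.vec N (\<lambda>b. if b < n then d b else 0)) =
    (\<Sum>a<n. \<Sum>b<n. c a * d b * M $$ (a, b))"
proof -
  have trunc: "(\<Sum>a<N. (if a < n then h a else 0)) = (\<Sum>a<n. h a)" for h :: "nat \<Rightarrow> real"
    using n by (intro sum.mono_neutral_cong_right) auto
  have "vec_index (M *\<^sub>v Matrix.vec N (\<lambda>b. if b < n then d b else 0)) a = (\<Sum>b<n. M $$ (a, b) * d b)"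
    if "a < N" for a
    using M that trunc [of "\<lambda>b. M $$ (a, b) * d b"]
    by (simp add: scalar_prod_def atLeast0LessThan if_distrib cong: if_cong)
  then have "scalar_prod (Matrix.vec N (\<lambda>a. if a < n then c a else 0))
      (M *\<^sub>v Matrix.vec N (\<lambda>b. if b < n then d b else 0)) =
    (\<Sum>a<N. if a < n then c a * (\<Sum>b<n. M $$ (a, b) * d b) else 0)"
    using M by (simp add: scalar_prod_def atLeast0LessThan if_distrib mult.commute cong: if_cong)
      (intro sum.cong, auto)
  also have "\<dots> = (\<Sum>a<n. \<Sum>b<n. c a * d b * M $$ (a, b))"
    by (simp add: trunc sum_distrib_left mult_ac)
  finally show ?thesis .
qed

text \<open>Stated for a general multiplier \<open>g\<close> and matrix \<open>M\<close> to cover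
  two cases at once: \<open>g = 1\<close> with the identity matrix, where it says that
  \<open>\<iota>\<close> is isometric, and \<open>g\<close> a coordinate with the corresponding
  extension.\<close>

lemma weight_integral_eq_quadratic_form:
  assumes w: "suitable_weight \<Omega> w" and basis: "orthonormal_poly_basis \<Omega> w q n e"
    and \<iota>: "linear_poly_to_vec q N \<iota>" and unit: "\<And>a. a < n \<Longrightarrow> \<iota> (e a) = unit_vec N a"
    and M: "M \<in> carrier_mat N N" and n: "n \<le> N"
    and g: "real_polynomial_function g"
    and block: "\<And>a b. a < n \<Longrightarrow> b < n \<Longrightarrow>
      M $$ (a, b) = (LINT x:\<Omega>|lebesgue. w x * (e a x * e b x * g x))"
    and p: "p \<in> poly_space (int q)" and r: "r \<in> poly_space (int q)"
  shows "(LINT x:\<Omega>|lebesgue. w x * (p x * r x * g x)) = scalar_prod (\<iota> p) (M *\<^sub>v \<iota> r)"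
proof -
  have e: "e a \<in> poly_space (int q)" if "a < n" for a
    using basis that by (simp add: orthonormal_poly_basis_def)
  obtain c where c: "p = (\<lambda>x. \<Sum>a<n. c a * e a x)"
    using orthonormal_poly_basis_expansion [OF basis p] ..
  obtain d where d: "r = (\<lambda>x. \<Sum>a<n. d a * e a x)"
    using orthonormal_poly_basis_expansion [OF basis r] ..
  have "(LINT x:\<Omega>|lebesgue. w x * (p x * r x * g x)) =
      (\<Sum>a<n. \<Sum>b<n. c a * d b * (LINT x:\<Omega>|lebesgue. w x * (e a x * e b x * g x)))"
    unfolding c d
    using w e g by (intro weight_integral_bilinear) (auto intro: real_polynomial_function_poly_space)
  also have "\<dots> = (\<Sum>a<n. \<Sum>b<n. c a * d b * M $$ (a, b))"
    by (intro sum.cong) (auto simp: block)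
  also have "\<dots> = scalar_prod (\<iota> p) (M *\<^sub>v \<iota> r)"
    using e unit unfolding c d
    by (simp add: linear_poly_to_vec_expansion [OF \<iota>] scalar_prod_leading_block [OF M n])
  finally show ?thesis .
qed

section \<open>The quadrature formula\<close>

theorem theorem11:
  fixes \<Omega> :: "(real ^ 'd::finite) set"
    and w :: "real ^ 'd \<Rightarrow> real"
    and q n N :: nat
    and e :: "nat \<Rightarrow> real ^ 'd \<Rightarrow> real"
    and A B :: "'d \<Rightarrow> real mat"
    and \<iota> :: "(real ^ 'd \<Rightarrow> real) \<Rightarrow> real Matrix.vec"
    and u :: "nat \<Rightarrow> real Matrix.vec"
    and \<Lambda> :: "'d \<Rightarrow> nat \<Rightarrow> real"
    and f :: "real ^ 'd \<Rightarrow> real"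
  assumes "suitable_weight \<Omega> w"
    and "n = (CARD('d) + q) choose CARD('d)"
    and "orthonormal_poly_basis \<Omega> w q n e"
    and "\<And>i. A i = mat n n (\<lambda>(a, b). weight_inner \<Omega> w (e a) (mult_op \<Omega> w q i (e b)))"
    and "linear_poly_to_vec q N \<iota>"
    and "\<And>a. a < n \<Longrightarrow> \<iota> (e a) = unit_vec N a"
    and "symmetric_commuting_extensions n N A B"
    and "\<And>i p. p \<in> poly_space (int q - 1) \<Longrightarrow>
           B i *\<^sub>v \<iota> p = \<iota> (\<lambda>x. vec_nth x i * p x) \<and>
           \<iota> (\<lambda>x. vec_nth x i * p x) = \<iota> (mult_op \<Omega> w q i p)"
    and "orthonormal_vec_basis N u"
    and "\<And>i \<alpha>. \<alpha> < N \<Longrightarrow> eigenvector (B i) (u \<alpha>) (\<Lambda> i \<alpha>)"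
    and "f \<in> poly_space (2 * int q + 1)"
  shows "(LINT x:\<Omega>|lebesgue. w x * f x) =
         (\<Sum>\<alpha><N. (scalar_prod (\<iota> (\<lambda>x. 1)) (u \<alpha>))\<^sup>2 * f (\<chi> i. \<Lambda> i \<alpha>))"
proof -
  note w = assms(1) and basis = assms(3) and \<iota> = assms(5) and unit = assms(6)
  have n: "n \<le> N" and B: "\<And>i. B i \<in> carrier_mat N N"
    and sym: "\<And>i. transpose_mat (B i) = B i"
    and block: "\<And>i a b. a < n \<Longrightarrow> b < n \<Longrightarrow> B i $$ (a, b) = A i $$ (a, b)"
    using assms(7) by (auto simp: symmetric_commuting_extensions_def)
  have e: "e a \<in> poly_space (int q)" if "a < n" for a
    using basis that by (simp add: orthonormal_poly_basis_def)
  have u: "u \<alpha> \<in> carrier_vec N" if "\<alpha> < N" for \<alpha>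
    using assms(9) that by (simp add: orthonormal_vec_basis_def)
  have Bu: "B i *\<^sub>v u \<alpha> = \<Lambda> i \<alpha> \<cdot>\<^sub>v u \<alpha>" if "\<alpha> < N" for i \<alpha>
    using assms(10) [OF that] by (simp add: eigenvector_def)
  define node where "node \<alpha> = (\<chi> i. \<Lambda> i \<alpha>)" for \<alpha>
  \<comment> \<open>The quadrature sum as a functional of the integrand, so that it can be compared
    with the integral on monomials first.\<close>
  define Q where "Q g = (\<Sum>\<alpha><N. (scalar_prod (\<iota> (\<lambda>x. 1)) (u \<alpha>))\<^sup>2 * g (node \<alpha>))" for g
  have at_node: "scalar_prod (\<iota> (monomial_fun k)) (u \<alpha>) =
      monomial_fun k (node \<alpha>) * scalar_prod (\<iota> (\<lambda>x. 1)) (u \<alpha>)"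
    if "\<alpha> < N" "(\<Sum>i\<in>UNIV. k i) \<le> q" for k \<alpha>
    unfolding node_def
    using scalar_prod_joint_eigenvector [OF \<iota> B sym _ u [OF that(1)] Bu [OF that(1)] that(2)]
      assms(8) by simp

  \<comment> \<open>The common core of both parities: \<open>M\<close> represents multiplication by
    \<open>g\<close> on the leading block and has the values of \<open>g\<close> at the nodes as
    eigenvalues.\<close>
  have exact: "(LINT x:\<Omega>|lebesgue. w x * (monomial_fun k x * monomial_fun l x * g x)) =
      Q (\<lambda>x. monomial_fun k x * monomial_fun l x * g x)"
    if g: "real_polynomial_function g" and M: "M \<in> carrier_mat N N" "transpose_mat M = M"
      and Mg: "\<And>a b. a < n \<Longrightarrow> b < n \<Longrightarrow>
        M $$ (a, b) = (LINT x:\<Omega>|lebesgue. w x * (e a x * e b x * g x))"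
      and Mu: "\<And>\<alpha>. \<alpha> < N \<Longrightarrow> M *\<^sub>v u \<alpha> = g (node \<alpha>) \<cdot>\<^sub>v u \<alpha>"
      and kl: "(\<Sum>i\<in>UNIV. k i) \<le> q" "(\<Sum>i\<in>UNIV. l i) \<le> q"
    for g M k l
  proof -
    have kl_space: "monomial_fun k \<in> poly_space (int q)" "monomial_fun l \<in> poly_space (int q)"
      using kl by (simp_all only: monomial_fun_poly_space_le)
    then have \<iota>kl: "\<iota> (monomial_fun k) \<in> carrier_vec N" "\<iota> (monomial_fun l) \<in> carrier_vec N"
      using \<iota> by (auto simp: linear_poly_to_vec_def)
    have Ml: "scalar_prod (M *\<^sub>v \<iota> (monomial_fun l)) (u \<alpha>) =
        g (node \<alpha>) * scalar_prod (\<iota> (monomial_fun l)) (u \<alpha>)" if "\<alpha> < N" for \<alpha>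
      using scalar_prod_symmetric_mat [OF M \<iota>kl(2) u [OF that]] \<iota>kl u [OF that]
      by (simp add: Mu [OF that])
    have "(LINT x:\<Omega>|lebesgue. w x * (monomial_fun k x * monomial_fun l x * g x)) =
        scalar_prod (\<iota> (monomial_fun k)) (M *\<^sub>v \<iota> (monomial_fun l))"
      using weight_integral_eq_quadratic_form [OF w basis \<iota> unit M(1) n g Mg kl_space] by simp
    \<comment> \<open>Parseval in the eigenbasis. Each factor then yields a value at the node times
      the scalar product of \<open>\<iota> 1\<close> with \<open>u \<alpha>\<close>, which accounts
      for the squared weight.\<close>
    also have "\<dots> = (\<Sum>\<alpha><N. scalar_prod (\<iota> (monomial_fun k)) (u \<alpha>) *
        scalar_prod (M *\<^sub>v \<iota> (monomial_fun l)) (u \<alpha>))"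
      using assms(9) M(1) \<iota>kl
      by (intro scalar_prod_orthonormal_expansion) (auto simp: orthonormal_vec_basis_def)
    also have "\<dots> = Q (\<lambda>x. monomial_fun k x * monomial_fun l x * g x)"
      unfolding Q_def
      by (intro sum.cong) (auto simp: Ml at_node kl power2_eq_square)
    finally show ?thesis .
  qed

  \<comment> \<open>For the identity matrix the entry condition is the orthonormality of
    \<open>e\<close>, and every eigenvalue is \<open>1\<close>.\<close>
  have exact_even: "(LINT x:\<Omega>|lebesgue. w x * (monomial_fun k x * monomial_fun l x)) =
      Q (\<lambda>x. monomial_fun k x * monomial_fun l x)"
    if "(\<Sum>i\<in>UNIV. k i) \<le> q" "(\<Sum>i\<in>UNIV. l i) \<le> q" for k l
    using exact [of "\<lambda>_. 1" "1\<^sub>m N" k l] that basis n u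
    by (simp add: orthonormal_poly_basis_def weight_inner_eq real_polynomial_function.intros)

  have exact_odd: "(LINT x:\<Omega>|lebesgue. w x * (monomial_fun k x * monomial_fun l x * vec_nth x i)) =
      Q (\<lambda>x. monomial_fun k x * monomial_fun l x * vec_nth x i)"
    if "(\<Sum>i\<in>UNIV. k i) \<le> q" "(\<Sum>i\<in>UNIV. l i) \<le> q" for k l i
  proof (rule exact [OF real_polynomial_function_vec_nth B sym])
    fix a b assume "a < n" "b < n"
    then show "B i $$ (a, b) = (LINT x:\<Omega>|lebesgue. w x * (e a x * e b x * vec_nth x i))"
      \<comment> \<open>On the leading block \<open>B i\<close> agrees with \<open>A i\<close>,
        whose entries are integrals once the projection is removed.\<close>
      using weight_inner_mult_op [OF w basis e e] by (simp add: block assms(4))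
  qed (use that Bu in \<open>auto simp: node_def\<close>)

  have exact_mono: "(LINT x:\<Omega>|lebesgue. w x * monomial_fun k x) = Q (monomial_fun k)"
    if "k \<in> multi_indices (2 * int q + 1)" for k
  proof -
    have "(\<Sum>i\<in>UNIV. k i) \<le> 2 * q + 1"
      using that by (simp add: multi_indices_def flip: of_nat_sum)
    then show ?thesis
      by (cases rule: monomial_fun_split_odd) (auto simp: exact_even exact_odd)
  qed

  obtain c where f: "f = (\<lambda>x. \<Sum>k\<in>multi_indices (2 * int q + 1). c k * monomial_fun k x)"
    using assms(11) by (auto simp: poly_space_def)
  \<comment> \<open>Integral and quadrature sum are both linear, so agreement on monomials carries
    over to \<open>f\<close>.\<close>
  have "(LINT x:\<Omega>|lebesgue. w x * f x) =
      (\<Sum>k\<in>multi_indices (2 * int q + 1). c k * (LINT x:\<Omega>|lebesgue. w x * monomial_fun k x))"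
    unfolding f using w
    by (intro weight_integral_sum finite_multi_indices)
      (auto intro: real_polynomial_function_poly_space monomial_fun_poly_space)
  also have "\<dots> = (\<Sum>k\<in>multi_indices (2 * int q + 1). c k * Q (monomial_fun k))"
    by (simp add: exact_mono)
  also have "\<dots> = Q f"
    unfolding f Q_def sum_distrib_left
    by (subst sum.swap) (simp add: mult_ac)
  finally show ?thesis by (simp add: Q_def node_def)
qed

end
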